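(* Let $G=(V,E)$ be a directed graph with edge weights $w\in\mathbb{R}^{E}_{\ge0}$, let $s,t\in V$ with $s\ne t$ and $t$ reachable from $s$, and let $\varepsilon\ge0$. Let $\mathcal D(\varepsilon)$ be either $\mathcal D^{\mathrm{S},\infty}(\varepsilon)$ or $\mathcal D^{\mathrm{S},1}(\varepsilon)$. Then the short-term Diff-RSP algorithm described in the context, run for the regime $\mathcal D(\varepsilon)$, returns an optimal path-incidence vector $f^\star$, i.e. a minimizer over $f\in\mathcal P_{s,t}$ of $\max_{(\Delta^+,\Delta^-)\in\mathcal D(\varepsilon)} f^\top(w+\Delta^+-\Delta^-)$, together with the optimal robust value $$\mathrm{OPT}_{\mathrm{RSP}}(w,\mathcal D(\varepsilon))=\min_{f\in\mathcal P_{s,t}}\ \max_{(\Delta^+,\Delta^-)\in\mathcal D(\varepsilon)} f^\top\bigl(w+\Delta^+-\Delta^-\bigr).$$ In both cases the running time is $O(|E|+|V|\log|V|)$.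
   Context: Vectors in $\mathbb{R}^m$, $m=|E|$, are indexed by edges. For $u\in V$, $E_{\mathrm{in}}(u)$ and $E_{\mathrm{out}}(u)$ are the sets of edges entering and leaving $u$. For $p\in\{1,\infty\}$, $\mathcal D^{\mathrm{S},p}(\varepsilon)$ is the set of all $(\Delta^+,\Delta^-)\in\mathbb{R}^{2m}_{\ge 0}$ with $\sum_{e\in E_{\mathrm{in}}(u)}\Delta^-_e=\sum_{e\in E_{\mathrm{out}}(u)}\Delta^+_e$ for all $u\in V$, $\Delta^-\le w$ entrywise, and $\|(\Delta^+,\Delta^-)\|_p\le\varepsilon$. $\mathcal P_{s,t}=\{f\in\{0,1\}^m: Bf=e_s-e_t\}$, where $B$ is the node–edge incidence matrix ($+1$ at the tail, $-1$ at the head of each edge) and $e_u$ is the $u$-th standard basis vector. Preprocessing quantities. For $u\in V$: $T_u=\sum_{e\in E_{\mathrm{in}}(u)}\min\{\varepsilon,w_e\}$. For an edge $e=(v,u)$: $\chi_e=0$ if $u=t$, and $\chi_e=\min\{\varepsilon,\;T_u-\min\{\varepsilon,w_e\}\}$ if $u\ne t$. Let $c_s=\min\{\varepsilon,T_s\}$ and $w^{\mathrm{wc}}_e=w_e+\chi_e$ for $e\in E$. Algorithm (input: $G,w,s,t,\varepsilon$, and the regime). First compute all $T_u$, $\chi_e$, $w^{\mathrm{wc}}$, $c_s$. - Regime $\mathcal D^{\mathrm{S},\infty}(\varepsilon)$: compute a shortest $s$–$t$ path with edge weights $w^{\mathrm{wc}}$, let $f^\star$ be its incidence vector, and return $f^\star$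 and the value $(w^{\mathrm{wc}})^\top f^\star+c_s$. - Regime $\mathcal D^{\mathrm{S},1}(\varepsilon)$: compute a shortest $s$–$t$ path with edge weights $w^{\mathrm{wc}}$, with incidence vector $f^{(1)}$, and set $\mathrm{VAL}^{(1)}=(w^{\mathrm{wc}})^\top f^{(1)}+T_s$; compute a shortest $s$–$t$ path with edge weights $w$, with incidence vector $f^{(0)}$, and set $\mathrm{VAL}^{(0)}=w^\top f^{(0)}+\varepsilon/2$. If $\mathrm{VAL}^{(1)}\le\mathrm{VAL}^{(0)}$ return $f^\star=f^{(1)}$ and the value $\mathrm{VAL}^{(1)}$; otherwise return $f^\star=f^{(0)}$ and the value $\mathrm{VAL}^{(0)}$. Shortest paths are simple directed paths. The graph is given by incoming adjacency lists, shortest paths with nonnegative weights are computed by Dijkstra's algorithm in $O(|E|+|V|\log|V|)$ time, and arithmetic operations and comparisons have unit cost. *)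

theory Defs
  imports
    "Graph_Theory.Shortest_Path"
    "HOL-Library.FuncSet"
    "HOL-Library.Landau_Symbols"
    "HOL-Library.Monad_Syntax"
begin

section \<open>The robust shortest path problem\<close>

text \<open>
  Graphs are finite directed multigraphs: loops and parallel arcs are allowed. A vector in
  \<open>\<real>\<^sup>E\<close> is a function that is \<open>undefined\<close> off the arcs (\<open>PiE\<close>), so that vectors that agree
  on all arcs are equal.
\<close>

text \<open>Entry of the node-arc incidence matrix; the column of a loop is zero.\<close>

definition incidence_matrix :: "('v, 'e) pre_digraph \<Rightarrow> 'v \<Rightarrow> 'e \<Rightarrow> real" where
  "incidence_matrix G u e = of_bool (tail G e = u) - of_bool (head G e = u)"

definition path_vectors :: "('v, 'e) pre_digraph \<Rightarrow> 'v \<Rightarrow> 'v \<Rightarrow> ('e \<Rightarrow> real) set" where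
  "path_vectors G s t =
     {f \<in> arcs G \<rightarrow>\<^sub>E {0, 1}.
        \<forall>u\<in>verts G. (\<Sum>e\<in>arcs G. incidence_matrix G u e * f e) = of_bool (u = s) - of_bool (u = t)}"

definition incidence_vector :: "('v, 'e) pre_digraph \<Rightarrow> 'e list \<Rightarrow> 'e \<Rightarrow> real" where
  "incidence_vector G p = (\<lambda>e\<in>arcs G. of_bool (e \<in> set p))"

datatype regime = L1 | LInf

text \<open>The norm of the concatenated vector \<open>(\<Delta>\<^sup>+, \<Delta>\<^sup>-)\<close>, whose index set is two copies of \<open>A\<close>.
  The inserted \<open>0\<close> only matters if \<open>A\<close> is empty.\<close>

fun pair_norm :: "regime \<Rightarrow> 'e set \<Rightarrow> ('e \<Rightarrow> real) \<times> ('e \<Rightarrow> real) \<Rightarrow> real" where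
  "pair_norm L1 A (dp, dm) = (\<Sum>e\<in>A. \<bar>dp e\<bar>) + (\<Sum>e\<in>A. \<bar>dm e\<bar>)"
| "pair_norm LInf A (dp, dm) = Max (insert 0 ((\<lambda>e. \<bar>dp e\<bar>) ` A \<union> (\<lambda>e. \<bar>dm e\<bar>) ` A))"

definition diff_set ::
  "regime \<Rightarrow> ('v, 'e) pre_digraph \<Rightarrow> ('e \<Rightarrow> real) \<Rightarrow> real \<Rightarrow> (('e \<Rightarrow> real) \<times> ('e \<Rightarrow> real)) set" where
  "diff_set r G w \<epsilon> =
     {(dp, dm). dp \<in> arcs G \<rightarrow>\<^sub>E {0..} \<and> dm \<in> arcs G \<rightarrow>\<^sub>E {0..} \<and>
        (\<forall>u\<in>verts G. (\<Sum>e\<in>in_arcs G u. dm e) = (\<Sum>e\<in>out_arcs G u. dp e)) \<and>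
        (\<forall>e\<in>arcs G. dm e \<le> w e) \<and>
        pair_norm r (arcs G) (dp, dm) \<le> \<epsilon>}"

definition perturbed_cost ::
  "('v, 'e) pre_digraph \<Rightarrow> ('e \<Rightarrow> real) \<Rightarrow> ('e \<Rightarrow> real) \<Rightarrow> ('e \<Rightarrow> real) \<times> ('e \<Rightarrow> real) \<Rightarrow> real" where
  "perturbed_cost G w f = (\<lambda>(dp, dm). \<Sum>e\<in>arcs G. f e * (w e + dp e - dm e))"

text \<open>As a supremum, this is the intended maximum only if the maximum is attained; attainment is
  to be asserted wherever it is used.\<close>

definition worst_case_cost ::
  "('v, 'e) pre_digraph \<Rightarrow> ('e \<Rightarrow> real) \<Rightarrow> (('e \<Rightarrow> real) \<times> ('e \<Rightarrow> real)) set \<Rightarrow> ('e \<Rightarrow> real) \<Rightarrow> real" where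
  "worst_case_cost G w D f = (SUP d\<in>D. perturbed_cost G w f d)"

definition opt_rsp ::
  "('v, 'e) pre_digraph \<Rightarrow> ('e \<Rightarrow> real) \<Rightarrow> 'v \<Rightarrow> 'v \<Rightarrow> (('e \<Rightarrow> real) \<times> ('e \<Rightarrow> real)) set \<Rightarrow> real" where
  "opt_rsp G w s t D = Min (worst_case_cost G w D ` path_vectors G s t)"


section \<open>Unit-cost computations\<close>

text \<open>A computation is its result together with the number of unit-cost steps taken. In the
  programs below, \<open>step\<close> is applied to exactly one array or list access, array update, arithmetic
  operation or comparison at a time. Arrays over vertices or arcs are functions; an array
  that has not been written yet is \<open>undefined\<close> everywhere.\<close>

type_synonym 'a timed = "'a \<times> nat"

definition return :: "'a \<Rightarrow> 'a timed" where
  "return x = (x, 0)"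

definition step :: "'a \<Rightarrow> 'a timed" where
  "step x = (x, 1)"

definition bind_timed :: "'a timed \<Rightarrow> ('a \<Rightarrow> 'b timed) \<Rightarrow> 'b timed" where
  "bind_timed m k = (fst (k (fst m)), snd m + snd (k (fst m)))"

adhoc_overloading Monad_Syntax.bind \<rightleftharpoons> bind_timed

primrec for_each :: "'a list \<Rightarrow> ('a \<Rightarrow> 's \<Rightarrow> 's timed) \<Rightarrow> 's \<Rightarrow> 's timed" where
  "for_each [] body \<sigma> = step \<sigma>"
| "for_each (x # xs) body \<sigma> = do { y \<leftarrow> step x; \<sigma>' \<leftarrow> body y \<sigma>; for_each xs body \<sigma>' }"


section \<open>Input representation and shortest paths\<close>

text \<open>Incoming adjacency lists: \<open>inlist R u\<close> lists the arcs entering \<open>u\<close>, each paired with its tail.\<close>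

record ('v, 'e) in_adjacency =
  vlist :: "'v list"
  inlist :: "'v \<Rightarrow> ('e \<times> 'v) list"

definition represents :: "('v, 'e) in_adjacency \<Rightarrow> ('v, 'e) pre_digraph \<Rightarrow> bool" where
  "represents R G \<longleftrightarrow>
     distinct (vlist R) \<and> set (vlist R) = verts G \<and>
     (\<forall>u\<in>verts G. distinct (inlist R u) \<and> set (inlist R u) = (\<lambda>e. (e, tail G e)) ` in_arcs G u)"

definition sp_instance ::
  "('v, 'e) pre_digraph \<Rightarrow> ('v, 'e) in_adjacency \<Rightarrow> ('e \<Rightarrow> real) \<Rightarrow> 'v \<Rightarrow> 'v \<Rightarrow> bool" where
  "sp_instance G R w s t \<longleftrightarrow>
     fin_digraph G \<and> represents R G \<and> (\<forall>e\<in>arcs G. 0 \<le> w e) \<and>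
     s \<in> verts G \<and> t \<in> verts G \<and> s \<noteq> t \<and> s \<rightarrow>\<^sup>*\<^bsub>G\<^esub> t"

definition shortest_path ::
  "('v, 'e) pre_digraph \<Rightarrow> ('e \<Rightarrow> real) \<Rightarrow> 'v \<Rightarrow> 'e list \<Rightarrow> 'v \<Rightarrow> bool" where
  "shortest_path G w s p t \<longleftrightarrow>
     is_arg_min (wf_digraph.awalk_cost w) (\<lambda>q. pre_digraph.apath G s q t) p"

text \<open>The known facts about Dijkstra's algorithm. \<open>O[principal S](g)\<close> bounds uniformly over all
  inputs in \<open>S\<close>; since \<open>s \<noteq> t\<close>, there are at least two vertices and the bound is positive.\<close>

definition dijkstra_procedure ::
  "(('v, 'e) in_adjacency \<Rightarrow> ('e \<Rightarrow> real) \<Rightarrow> 'v \<Rightarrow> 'v \<Rightarrow> 'e list timed) \<Rightarrow> bool" where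
  "dijkstra_procedure sp \<longleftrightarrow>
     (\<forall>G R w s t. sp_instance G R w s t \<longrightarrow> shortest_path G w s (fst (sp R w s t)) t) \<and>
     (\<lambda>(G, R, w, s, t). real (snd (sp R w s t)))
        \<in> O[principal {(G, R, w, s, t). sp_instance G R w s t}](\<lambda>(G, R, w, s, t). real (card (arcs G))
               + real (card (verts G)) * ln (real (card (verts G))))"


section \<open>The algorithm\<close>

definition compute_T ::
  "('v, 'e) in_adjacency \<Rightarrow> ('e \<Rightarrow> real) \<Rightarrow> real \<Rightarrow> ('v \<Rightarrow> real) timed" where
  "compute_T R w \<epsilon> =
     for_each (vlist R) (\<lambda>u T. do {
       es \<leftarrow> step (inlist R u);
       x \<leftarrow> for_each es (\<lambda>(e, v) acc. do {
         we \<leftarrow> step (w e);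
         c \<leftarrow> step (min \<epsilon> we);
         step (acc + c)
       }) 0;
       step (T(u := x))
     }) (\<lambda>_. undefined)"

definition compute_chi_wwc ::
  "('v, 'e) in_adjacency \<Rightarrow> ('e \<Rightarrow> real) \<Rightarrow> 'v \<Rightarrow> real \<Rightarrow> ('v \<Rightarrow> real)
     \<Rightarrow> (('e \<Rightarrow> real) \<times> ('e \<Rightarrow> real)) timed" where
  "compute_chi_wwc R w t \<epsilon> T =
     for_each (vlist R) (\<lambda>u \<sigma>. do {
       es \<leftarrow> step (inlist R u);
       Tu \<leftarrow> step (T u);
       is_t \<leftarrow> step (u = t);
       for_each es (\<lambda>(e, v) (\<chi>, wwc). do {
         we \<leftarrow> step (w e);
         x \<leftarrow> (if is_t then step 0 else do {
           c \<leftarrow> step (min \<epsilon> we);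
           r \<leftarrow> step (Tu - c);
           step (min \<epsilon> r)
         });
         \<chi>' \<leftarrow> step (\<chi>(e := x));
         y \<leftarrow> step (we + x);
         wwc' \<leftarrow> step (wwc(e := y));
         return (\<chi>', wwc')
       }) \<sigma>
     }) (\<lambda>_. undefined, \<lambda>_. undefined)"

definition preprocess ::
  "('v, 'e) in_adjacency \<Rightarrow> ('e \<Rightarrow> real) \<Rightarrow> 'v \<Rightarrow> 'v \<Rightarrow> real
     \<Rightarrow> (('v \<Rightarrow> real) \<times> ('e \<Rightarrow> real) \<times> ('e \<Rightarrow> real) \<times> real) timed" where
  "preprocess R w s t \<epsilon> = do {
     T \<leftarrow> compute_T R w \<epsilon>;
     (\<chi>, wwc) \<leftarrow> compute_chi_wwc R w t \<epsilon> T;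
     Ts \<leftarrow> step (T s);
     cs \<leftarrow> step (min \<epsilon> Ts);
     return (T, \<chi>, wwc, cs)
   }"

definition compute_incidence :: "('v, 'e) in_adjacency \<Rightarrow> 'e list \<Rightarrow> ('e \<Rightarrow> real) timed" where
  "compute_incidence R p = do {
     z \<leftarrow> for_each (vlist R) (\<lambda>u f. do {
       es \<leftarrow> step (inlist R u);
       for_each es (\<lambda>(e, v) f. step (f(e := 0))) f
     }) (\<lambda>_. undefined);
     for_each p (\<lambda>e f. step (f(e := 1))) z
   }"

definition compute_inner ::
  "('v, 'e) in_adjacency \<Rightarrow> ('e \<Rightarrow> real) \<Rightarrow> ('e \<Rightarrow> real) \<Rightarrow> real timed" where
  "compute_inner R x f =
     for_each (vlist R) (\<lambda>u acc. do {
       es \<leftarrow> step (inlist R u);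
       for_each es (\<lambda>(e, v) acc. do {
         xe \<leftarrow> step (x e);
         fe \<leftarrow> step (f e);
         m \<leftarrow> step (xe * fe);
         step (acc + m)
       }) acc
     }) 0"

fun short_term_rsp ::
  "(('v, 'e) in_adjacency \<Rightarrow> ('e \<Rightarrow> real) \<Rightarrow> 'v \<Rightarrow> 'v \<Rightarrow> 'e list timed) \<Rightarrow> regime
     \<Rightarrow> ('v, 'e) in_adjacency \<Rightarrow> ('e \<Rightarrow> real) \<Rightarrow> 'v \<Rightarrow> 'v \<Rightarrow> real \<Rightarrow> (('e \<Rightarrow> real) \<times> real) timed" where
  "short_term_rsp dijkstra LInf R w s t \<epsilon> = do {
     (T, \<chi>, wwc, cs) \<leftarrow> preprocess R w s t \<epsilon>;
     p \<leftarrow> dijkstra R wwc s t;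
     f \<leftarrow> compute_incidence R p;
     c \<leftarrow> compute_inner R wwc f;
     val \<leftarrow> step (c + cs);
     return (f, val)
   }"
| "short_term_rsp dijkstra L1 R w s t \<epsilon> = do {
     (T, \<chi>, wwc, cs) \<leftarrow> preprocess R w s t \<epsilon>;
     p1 \<leftarrow> dijkstra R wwc s t;
     f1 \<leftarrow> compute_incidence R p1;
     c1 \<leftarrow> compute_inner R wwc f1;
     Ts \<leftarrow> step (T s);
     val1 \<leftarrow> step (c1 + Ts);
     p0 \<leftarrow> dijkstra R w s t;
     f0 \<leftarrow> compute_incidence R p0;
     c0 \<leftarrow> compute_inner R w f0;
     h \<leftarrow> step (\<epsilon> / 2);
     val0 \<leftarrow> step (c0 + h);
     first \<leftarrow> step (val1 \<le> val0);
     (if first then return (f1, val1) else return (f0, val0))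
   }"

end

theory Submission
  imports Defs "HOL-Analysis.Function_Topology"
begin

text \<open>
  The adversary moves cost: what it removes from the arcs entering a vertex \<open>u\<close> it must add to the
  arcs leaving \<open>u\<close>. Along a simple \<open>s\<close>-\<open>t\<close> path these moves are independent of each other, because at
  most one path arc enters and at most one leaves each vertex. At an interior vertex, entered by the
  path arc \<open>e\<close>, moving cost from \<open>e\<close> to the next path arc leaves the path cost unchanged, so
  the best move takes from the other entering arcs, which together can give up
  \<open>T\<^sub>u - min \<epsilon> w\<^sub>e\<close>; at \<open>s\<close> all entering arcs can give; at \<open>t\<close> no path arc receives. In the sup-norm
  regime an arc can receive at most \<open>\<epsilon>\<close>, so the worst case of a path is its length under the weights
  \<open>w + \<chi>\<close> plus the constant \<open>min \<epsilon> T\<^sub>s\<close> (\<open>worst_case_LInf\<close>). In the \<open>L\<^sub>1\<close> regime half of the budget is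
  spent on removing, so the total gain is also capped by \<open>\<epsilon> / 2\<close>; scaling all moves by a common factor
  shows that the worst case is the smaller of the length under \<open>w + \<chi>\<close> plus \<open>T\<^sub>s\<close> and the length under \<open>w\<close>
  plus \<open>\<epsilon> / 2\<close> (\<open>worst_case_L1\<close>). A minimum over paths of a minimum of two expressions is the smaller of the two minima, hence two shortest path
  computations suffice.

  Vectors in \<open>\<P>\<^sub>s\<^sub>t\<close> need not be simple paths: they may contain additional cycles. But each of them
  contains the arcs of a simple path (\<open>path_vector_contains_apath\<close>, a cut argument), and perturbed
  weights are never negative, so dropping the other arcs does not increase the cost under any
  perturbation (\<open>apath_cheapest_in_path_vector\<close>). For such general vectors the maximum over the
  perturbations exists by compactness (\<open>compact_diff_set\<close>).

  The running time is that of at most two calls of the shortest path procedure plus a linear number of steps;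
  the latter is within the bound because \<open>s \<noteq> t\<close> forces \<open>|V| \<ge> 2\<close>.
\<close>

section \<open>Path vectors\<close>

context fin_digraph
begin

lemma sum_arcs_by_head: "(\<Sum>e\<in>arcs G. h e) = (\<Sum>u\<in>verts G. \<Sum>e\<in>in_arcs G u. h e)"
  unfolding in_arcs_def by (rule sum.group[symmetric]) auto

lemma sum_arcs_by_tail: "(\<Sum>e\<in>arcs G. h e) = (\<Sum>u\<in>verts G. \<Sum>e\<in>out_arcs G u. h e)"
  unfolding out_arcs_def by (rule sum.group[symmetric]) auto

lemma apath_distinct: "apath u p v \<Longrightarrow> distinct p"
  unfolding apath_def by (auto intro: distinct_verts_imp_distinct)

lemma apath_arcs: "apath u p v \<Longrightarrow> set p \<subseteq> arcs G"
  by (auto simp: apath_def)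

lemma apath_inj_head: "apath u p v \<Longrightarrow> inj_on (head G) (set p)"
  unfolding apath_def by (cases "p = []") (auto simp: awalk_verts_conv' distinct_map elim!: awalkE')

lemma apath_inj_tail: "apath u p v \<Longrightarrow> inj_on (tail G) (set p)"
  unfolding apath_def by (cases "p = []") (auto simp: awalk_verts_conv distinct_map)

lemma apath_head_neq_start: "apath u p v \<Longrightarrow> e \<in> set p \<Longrightarrow> head G e \<noteq> u"
  unfolding apath_def
  by (cases "p = []") (auto simp: awalk_verts_conv' cas_simp elim!: awalkE')

lemma apath_tail_neq_end: "apath u p v \<Longrightarrow> e \<in> set p \<Longrightarrow> tail G e \<noteq> v"
proof (induction p arbitrary: u)
  case (Cons a p)
  then have "v \<in> set (awalk_verts (head G a) p)"
    by (auto simp: apath_Cons_iff apath_def)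
  with Cons show ?case by (auto simp: apath_Cons_iff)
qed simp

text \<open>
  The tails of a walk followed by its end are the same vertices as its start followed by its heads.
\<close>

lemma awalk_shift_sum:
  fixes b :: "'a \<Rightarrow> real"
  assumes "awalk u p v"
  shows "(\<Sum>e\<leftarrow>p. b (tail G e)) + b v = b u + (\<Sum>e\<leftarrow>p. b (head G e))"
  using assms by (induction p arbitrary: u) (auto simp: awalk_simps)

lemma sum_incidence_vector:
  assumes "apath u p v"
  shows "(\<Sum>e\<in>arcs G. incidence_vector G p e * h e) = (\<Sum>e\<leftarrow>p. h e)"
proof -
  have "(\<Sum>e\<in>arcs G. incidence_vector G p e * h e) = (\<Sum>e\<in>arcs G. if e \<in> set p then h e else 0)"
    by (intro sum.cong) (auto simp: incidence_vector_def)
  also have "\<dots> = (\<Sum>e\<in>set p. h e)"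
    using apath_arcs[OF assms] by (simp add: sum.inter_restrict[symmetric] Int_absorb1)
  finally show ?thesis
    using apath_distinct[OF assms] by (simp add: sum_list_distinct_conv_sum_set)
qed

lemma incidence_vector_in_path_vectors:
  assumes p: "apath s p t"
  shows "incidence_vector G p \<in> path_vectors G s t"
proof -
  have "(\<Sum>e\<in>arcs G. incidence_matrix G x e * incidence_vector G p e)
          = of_bool (x = s) - of_bool (x = t)" for x
  proof -
    have "(\<Sum>e\<leftarrow>p. incidence_matrix G x e)
        = (\<Sum>e\<leftarrow>p. of_bool (tail G e = x)) - (\<Sum>e\<leftarrow>p. of_bool (head G e = x))"
      by (simp add: incidence_matrix_def sum_list_subtractf)
    then show ?thesis
      using awalk_shift_sum[of s p t "\<lambda>y. of_bool (y = x)"] p sum_incidence_vector[OF p]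
      by (auto simp: apath_def mult.commute eq_commute[of x])
  qed
  then show ?thesis
    by (auto simp: path_vectors_def incidence_vector_def)
qed

lemma finite_path_vectors: "finite (path_vectors G s t)"
  by (rule finite_subset[of _ "arcs G \<rightarrow>\<^sub>E {0, 1}"]) (auto simp: path_vectors_def intro: finite_PiE)

text \<open>
  Otherwise let \<open>H\<close> be the set of vertices reachable from \<open>s\<close> along arcs of \<open>g\<close>. The balance equations,
  summed over \<open>H\<close>, say that the net flow of \<open>g\<close> out of \<open>H\<close> is \<open>1\<close>, although no arc of \<open>g\<close> leaves \<open>H\<close>.
\<close>

lemma path_vector_contains_apath:
  assumes g: "g \<in> path_vectors G s t" and s: "s \<in> verts G" and st: "s \<noteq> t"
  shows "\<exists>p. apath s p t \<and> (\<forall>e\<in>set p. g e = 1)"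
proof (rule ccontr)
  assume no_path: "\<not> ?thesis"
  define H where "H = {u. \<exists>p. awalk s p u \<and> (\<forall>e\<in>set p. g e = 1)}"
  have g01: "g e = 0 \<or> g e = 1" if "e \<in> arcs G" for e
    using g that by (auto simp: path_vectors_def PiE_iff)
  have H_verts: "H \<subseteq> verts G" by (auto simp: H_def)
  have "s \<in> H" using s by (auto simp: H_def awalk_Nil_iff intro!: exI[of _ "[]"])
  have "t \<notin> H"
  proof
    assume "t \<in> H"
    then obtain p where p: "awalk s p t" "\<forall>e\<in>set p. g e = 1" by (auto simp: H_def)
    have "apath s (awalk_to_apath p) t" "set (awalk_to_apath p) \<subseteq> set p"
      using p(1) by (auto intro: apath_awalk_to_apath dest: awalk_to_apath_subset)
    with p(2) no_path show False by blast
  qed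
  have H_closed: "head G e \<in> H" if "e \<in> arcs G" "g e = 1" "tail G e \<in> H" for e
  proof -
    obtain p where "awalk s p (tail G e)" "\<forall>e\<in>set p. g e = 1"
      using \<open>tail G e \<in> H\<close> unfolding H_def by blast
    then have "awalk s (p @ [e]) (head G e)" "\<forall>e\<in>set (p @ [e]). g e = 1"
      using that arc_implies_awalk by (blast intro: awalk_appendI, auto)
    then show ?thesis unfolding H_def by blast
  qed
  have fin: "finite H" using H_verts finite_verts by (rule finite_subset)
  have "(\<Sum>u\<in>H. \<Sum>e\<in>arcs G. incidence_matrix G u e * g e)
      = (\<Sum>u\<in>H. of_bool (u = s) - of_bool (u = t))"
    using g H_verts by (intro sum.cong) (auto simp: path_vectors_def)
  also have "\<dots> = 1"
    using fin \<open>s \<in> H\<close> \<open>t \<notin> H\<close> by (simp add: sum_subtractf sum.delta of_bool_def)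
  finally have "(\<Sum>e\<in>arcs G. \<Sum>u\<in>H. incidence_matrix G u e * g e) = 1"
    by (subst sum.swap)
  moreover have "(\<Sum>u\<in>H. incidence_matrix G u e * g e) \<le> 0" if e: "e \<in> arcs G" for e
  proof -
    have "(\<Sum>u\<in>H. incidence_matrix G u e)
        = of_bool (tail G e \<in> H) - of_bool (head G e \<in> H)"
      using fin by (simp add: incidence_matrix_def sum_subtractf sum.delta' of_bool_def)
    then show ?thesis
      using H_closed[OF e] g01[OF e] by (auto simp: sum_distrib_right[symmetric])
  qed
  ultimately show False
    using sum_nonpos[of "arcs G" "\<lambda>e. \<Sum>u\<in>H. incidence_matrix G u e * g e"] by auto
qed

end

section \<open>The feasible perturbations\<close>

locale robust_sp = fin_digraph G for G :: "('v, 'e) pre_digraph" +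
  fixes w :: "'e \<Rightarrow> real" and s t :: 'v and \<epsilon> :: real
  assumes w_nonneg: "e \<in> arcs G \<Longrightarrow> 0 \<le> w e"
    and s_vert: "s \<in> verts G" and s_neq_t: "s \<noteq> t" and eps_nonneg: "0 \<le> \<epsilon>"
begin

text \<open>
  The names follow the preprocessing quantities: \<open>in_supply u\<close> is \<open>T\<^sub>u\<close>, and \<open>wwc\<close> is \<open>w\<^sup>w\<^sup>c\<close>, restricted
  to the arcs because the program leaves all other array entries undefined.
\<close>

definition in_supply :: "'v \<Rightarrow> real" where
  "in_supply u = (\<Sum>e\<in>in_arcs G u. min \<epsilon> (w e))"

definition chi :: "'e \<Rightarrow> real" where
  "chi e = (if head G e = t then 0 else min \<epsilon> (in_supply (head G e) - min \<epsilon> (w e)))"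

definition wwc :: "'e \<Rightarrow> real" where
  "wwc = (\<lambda>e\<in>arcs G. w e + chi e)"

lemma in_supply_nonneg: "0 \<le> in_supply u"
  unfolding in_supply_def using w_nonneg eps_nonneg by (intro sum_nonneg) auto

lemma in_supply_minus_arc:
  assumes "e \<in> arcs G"
  shows "in_supply (head G e) - min \<epsilon> (w e) = (\<Sum>a\<in>in_arcs G (head G e) - {e}. min \<epsilon> (w a))"
  using assms unfolding in_supply_def by (subst sum.remove[of _ e]) auto

lemma chi_nonneg: "e \<in> arcs G \<Longrightarrow> 0 \<le> chi e"
  using in_supply_minus_arc[of e] w_nonneg eps_nonneg
  by (auto simp: chi_def intro!: sum_nonneg)

lemma awalk_cost_wwc:
  "set p \<subseteq> arcs G \<Longrightarrow> awalk_cost wwc p = awalk_cost w p + (\<Sum>e\<leftarrow>p. chi e)"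
  by (induction p) (auto simp: wwc_def)

lemma pair_norm_LInf_le_iff:
  "pair_norm LInf (arcs G) (dp, dm) \<le> \<epsilon> \<longleftrightarrow> (\<forall>e\<in>arcs G. \<bar>dp e\<bar> \<le> \<epsilon> \<and> \<bar>dm e\<bar> \<le> \<epsilon>)"
  using eps_nonneg by auto

lemma diff_setD:
  assumes "(dp, dm) \<in> diff_set r G w \<epsilon>"
  shows "e \<in> arcs G \<Longrightarrow> 0 \<le> dp e" "e \<in> arcs G \<Longrightarrow> 0 \<le> dm e"
    "e \<in> arcs G \<Longrightarrow> dp e \<le> \<epsilon>" "e \<in> arcs G \<Longrightarrow> dm e \<le> min \<epsilon> (w e)"
    "u \<in> verts G \<Longrightarrow> (\<Sum>e\<in>in_arcs G u. dm e) = (\<Sum>e\<in>out_arcs G u. dp e)"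
proof -
  show dp: "0 \<le> dp e" if "e \<in> arcs G" for e
    using assms that by (auto simp: diff_set_def)
  show dm: "0 \<le> dm e" if "e \<in> arcs G" for e
    using assms that by (auto simp: diff_set_def)
  show "(\<Sum>e\<in>in_arcs G u. dm e) = (\<Sum>e\<in>out_arcs G u. dp e)" if "u \<in> verts G"
    using assms that by (auto simp: diff_set_def)
  have norm: "pair_norm r (arcs G) (dp, dm) \<le> \<epsilon>"
    using assms by (auto simp: diff_set_def)
  have "dp e \<le> \<epsilon> \<and> dm e \<le> \<epsilon>" if e: "e \<in> arcs G" for e
  proof (cases r)
    case L1
    have "dp e \<le> (\<Sum>e\<in>arcs G. \<bar>dp e\<bar>)" "dm e \<le> (\<Sum>e\<in>arcs G. \<bar>dm e\<bar>)"
      using member_le_sum[of e "arcs G" "\<lambda>e. \<bar>dp e\<bar>"] member_le_sum[of e "arcs G" "\<lambda>e. \<bar>dm e\<bar>"] e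
      by auto
    moreover have "0 \<le> (\<Sum>e\<in>arcs G. \<bar>dp e\<bar>)" "0 \<le> (\<Sum>e\<in>arcs G. \<bar>dm e\<bar>)"
      by (auto intro: sum_nonneg)
    moreover have "(\<Sum>e\<in>arcs G. \<bar>dp e\<bar>) + (\<Sum>e\<in>arcs G. \<bar>dm e\<bar>) \<le> \<epsilon>"
      using norm L1 by simp
    ultimately show ?thesis by linarith
  next
    case LInf
    then have "\<bar>dp e\<bar> \<le> \<epsilon> \<and> \<bar>dm e\<bar> \<le> \<epsilon>"
      using norm e pair_norm_LInf_le_iff by blast
    then show ?thesis by linarith
  qed
  then show "dp e \<le> \<epsilon>" "dm e \<le> min \<epsilon> (w e)" if "e \<in> arcs G"
    using assms that by (auto simp: diff_set_def)
qed

lemma zero_in_diff_set: "(\<lambda>e\<in>arcs G. 0, \<lambda>e\<in>arcs G. 0) \<in> diff_set r G w \<epsilon>"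
  using w_nonneg eps_nonneg by (cases r) (auto simp: diff_set_def intro!: sum.neutral)

text \<open>
  A closed subset of a product of compact intervals: the entries off the arcs are fixed, and on the arcs
  both regimes force values between \<open>0\<close> and \<open>\<epsilon>\<close>.
\<close>

lemma compact_diff_set: "compact (diff_set r G w \<epsilon>)"
proof -
  define K where "K = (PiE UNIV (\<lambda>e. if e \<in> arcs G then {0..\<epsilon>} else {undefined}) :: ('e \<Rightarrow> real) set)"
  have "compactin (product_topology (\<lambda>_. euclidean) UNIV) K"
    unfolding K_def compactin_PiE by auto
  then have "compact K" by (simp add: euclidean_product_topology)
  have cont: "continuous_on UNIV (\<lambda>d :: ('e \<Rightarrow> real) \<times> ('e \<Rightarrow> real). fst d e)"
    "continuous_on UNIV (\<lambda>d :: ('e \<Rightarrow> real) \<times> ('e \<Rightarrow> real). snd d e)" for e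
    using continuous_on_product_then_coordinatewise continuous_on_fst continuous_on_snd continuous_on_id
    by fast+
  have closed_bal: "closed {d. (\<Sum>e\<in>in_arcs G u. snd d e) = (\<Sum>e\<in>out_arcs G u. fst d e :: real)}"
    for u
    by (intro closed_Collect_eq continuous_on_sum cont)
  have closed_w: "closed {d :: ('e \<Rightarrow> real) \<times> ('e \<Rightarrow> real). snd d e \<le> w e}" for e
    by (intro closed_Collect_le continuous_on_const cont)
  have closed_norm: "closed {d. pair_norm r (arcs G) d \<le> \<epsilon>}"
  proof (cases r)
    case L1
    have "closed {d. (\<Sum>e\<in>arcs G. \<bar>fst d e\<bar>) + (\<Sum>e\<in>arcs G. \<bar>snd d e\<bar>) \<le> \<epsilon>}"
      by (intro closed_Collect_le continuous_on_add continuous_on_sum continuous_on_rabs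
          continuous_on_const cont)
    moreover have "{d. pair_norm r (arcs G) d \<le> \<epsilon>}
      = {d. (\<Sum>e\<in>arcs G. \<bar>fst d e\<bar>) + (\<Sum>e\<in>arcs G. \<bar>snd d e\<bar>) \<le> \<epsilon>}"
      using L1 by auto
    ultimately show ?thesis by simp
  next
    case LInf
    have "closed (\<Inter>e\<in>arcs G. {d. \<bar>fst d e\<bar> \<le> \<epsilon>} \<inter> {d. \<bar>snd d e\<bar> \<le> \<epsilon>})"
      by (intro closed_INT ballI closed_Int closed_Collect_le continuous_on_rabs
          continuous_on_const cont)
    moreover have "{d. pair_norm r (arcs G) d \<le> \<epsilon>}
      = (\<Inter>e\<in>arcs G. {d. \<bar>fst d e\<bar> \<le> \<epsilon>} \<inter> {d. \<bar>snd d e\<bar> \<le> \<epsilon>})"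
      unfolding LInf using pair_norm_LInf_le_iff by (auto simp del: pair_norm.simps)
    ultimately show ?thesis by simp
  qed
  define C where "C = (\<Inter>u\<in>verts G. {d. (\<Sum>e\<in>in_arcs G u. snd d e) = (\<Sum>e\<in>out_arcs G u. fst d e :: real)})
      \<inter> (\<Inter>e\<in>arcs G. {d. snd d e \<le> w e}) \<inter> {d. pair_norm r (arcs G) d \<le> \<epsilon>}"
  have "closed C"
    unfolding C_def
    by (intro closed_INT ballI closed_Int closed_bal closed_w closed_norm)
  have K_iff: "h \<in> K \<longleftrightarrow> h \<in> extensional (arcs G) \<and> (\<forall>e\<in>arcs G. 0 \<le> h e \<and> h e \<le> \<epsilon>)" for h
    unfolding K_def extensional_def by (auto simp: PiE_iff split: if_splits)
  have C_iff: "(dp, dm) \<in> C \<longleftrightarrow>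
      (\<forall>u\<in>verts G. (\<Sum>e\<in>in_arcs G u. dm e) = (\<Sum>e\<in>out_arcs G u. dp e)) \<and>
      (\<forall>e\<in>arcs G. dm e \<le> w e) \<and> pair_norm r (arcs G) (dp, dm) \<le> \<epsilon>" for dp dm
    unfolding C_def by auto
  have "(dp, dm) \<in> diff_set r G w \<epsilon> \<longleftrightarrow> dp \<in> K \<and> dm \<in> K \<and> (dp, dm) \<in> C" for dp dm
  proof
    assume d: "(dp, dm) \<in> diff_set r G w \<epsilon>"
    then have "dp \<in> extensional (arcs G)" "dm \<in> extensional (arcs G)" "(dp, dm) \<in> C"
      unfolding C_iff by (simp_all add: diff_set_def PiE_iff)
    with diff_setD[OF d] show "dp \<in> K \<and> dm \<in> K \<and> (dp, dm) \<in> C"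
      unfolding K_iff by simp
  next
    assume "dp \<in> K \<and> dm \<in> K \<and> (dp, dm) \<in> C"
    then show "(dp, dm) \<in> diff_set r G w \<epsilon>"
      unfolding K_iff C_iff by (simp add: diff_set_def PiE_iff)
  qed
  then have "diff_set r G w \<epsilon> = (K \<times> K) \<inter> C" by auto
  then show ?thesis
    using \<open>compact K\<close> \<open>closed C\<close> by (simp add: compact_Int_closed compact_Times)
qed

lemma max_attained: "\<exists>d. is_arg_max (perturbed_cost G w g) (\<lambda>d. d \<in> diff_set r G w \<epsilon>) d"
proof -
  have "continuous_on (diff_set r G w \<epsilon>) (perturbed_cost G w g)"
    unfolding perturbed_cost_def split_beta
    by (intro continuous_intros continuous_on_product_then_coordinatewise)
  then obtain d where "d \<in> diff_set r G w \<epsilon>"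
    "\<forall>d'\<in>diff_set r G w \<epsilon>. perturbed_cost G w g d' \<le> perturbed_cost G w g d"
    using continuous_attains_sup[OF compact_diff_set] zero_in_diff_set by blast
  then show ?thesis unfolding is_arg_max_def not_less by (metis not_less)
qed

section \<open>Upper bounds on the gain along a path\<close>

lemma sum_dp_eq_sum_dm:
  assumes "(dp, dm) \<in> diff_set r G w \<epsilon>"
  shows "(\<Sum>e\<in>arcs G. dp e) = (\<Sum>e\<in>arcs G. dm e)"
  unfolding sum_arcs_by_head[of dm] sum_arcs_by_tail[of dp]
  using diff_setD(5)[OF assms] by simp

lemma perturbed_cost_apath:
  assumes "apath u p v"
  shows "perturbed_cost G w (incidence_vector G p) (dp, dm)
    = awalk_cost w p + (\<Sum>e\<leftarrow>p. dp e - dm e)"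
proof -
  have "perturbed_cost G w (incidence_vector G p) (dp, dm) = (\<Sum>e\<leftarrow>p. w e + dp e - dm e)"
    using sum_incidence_vector[OF assms, of "\<lambda>e. w e + dp e - dm e"]
    by (simp add: perturbed_cost_def)
  also have "\<dots> = awalk_cost w p + (\<Sum>e\<leftarrow>p. dp e - dm e)"
    by (induction p) auto
  finally show ?thesis .
qed

lemma dp_le_inflow:
  assumes d: "(dp, dm) \<in> diff_set r G w \<epsilon>" and e: "e \<in> arcs G"
  shows "dp e \<le> (\<Sum>a\<in>in_arcs G (tail G e). dm a)"
proof -
  have "dp e \<le> (\<Sum>a\<in>out_arcs G (tail G e). dp a)"
    using diff_setD(1)[OF d] e by (intro member_le_sum) auto
  then show ?thesis using diff_setD(5)[OF d] e by simp
qed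

lemma dp_le_in_supply:
  assumes d: "(dp, dm) \<in> diff_set r G w \<epsilon>" and e: "e \<in> arcs G"
  shows "dp e \<le> in_supply (tail G e)"
proof -
  have "(\<Sum>a\<in>in_arcs G (tail G e). dm a) \<le> in_supply (tail G e)"
    unfolding in_supply_def using diff_setD(4)[OF d] by (intro sum_mono) auto
  then show ?thesis using dp_le_inflow[OF d e] by simp
qed

text \<open>
  What \<open>a\<close> receives at their common vertex is taken from all arcs entering it; the part taken from the
  path arc \<open>e\<close> is lost again, so only the other entering arcs contribute to the difference.
\<close>

lemma gain_consecutive_le_chi:
  assumes d: "(dp, dm) \<in> diff_set r G w \<epsilon>"
    and e: "e \<in> arcs G" "a \<in> arcs G" "head G e = tail G a" "head G e \<noteq> t"
  shows "dp a - dm e \<le> chi e"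
proof -
  have "(\<Sum>x\<in>in_arcs G (head G e) - {e}. dm x) \<le> (\<Sum>x\<in>in_arcs G (head G e) - {e}. min \<epsilon> (w x))"
    using diff_setD(4)[OF d] by (intro sum_mono) auto
  moreover have "(\<Sum>x\<in>in_arcs G (head G e). dm x) = dm e + (\<Sum>x\<in>in_arcs G (head G e) - {e}. dm x)"
    using e by (intro sum.remove) auto
  ultimately have "dp a - dm e \<le> in_supply (head G e) - min \<epsilon> (w e)"
    using dp_le_inflow[OF d e(2)] e in_supply_minus_arc[OF e(1)] by simp
  moreover have "dp a - dm e \<le> \<epsilon>"
    using diff_setD(2)[OF d, of e] diff_setD(3)[OF d, of a] e by simp
  ultimately show ?thesis using e by (simp add: chi_def)
qed

text \<open>
  Each removal is paired with the addition to the next arc of the path. This leaves the addition to the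
  first arc unpaired, and a removal on the last arc, which only lowers the cost; \<open>chi\<close> is \<open>0\<close> there.
\<close>

lemma gain_le:
  assumes d: "(dp, dm) \<in> diff_set r G w \<epsilon>"
  shows "apath u p t \<Longrightarrow> p \<noteq> [] \<Longrightarrow> (\<Sum>e\<leftarrow>p. dp e - dm e) \<le> dp (hd p) + (\<Sum>e\<leftarrow>p. chi e)"
proof (induction p arbitrary: u)
  case (Cons e p)
  show ?case
  proof (cases p)
    case Nil
    with Cons.prems show ?thesis
      using diff_setD(2)[OF d, of e] by (auto simp: apath_simps chi_def)
  next
    case (Cons a q)
    with Cons.prems have p: "apath (head G e) p t" "e \<in> arcs G" "a \<in> arcs G" "head G e = tail G a"
      by (auto simp: apath_Cons_iff)
    then have "head G e \<noteq> t"
      using Cons apath_nonempty_ends by blast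
    then show ?thesis
      using Cons.IH[OF p(1)] gain_consecutive_le_chi[OF d p(2-4)] Cons by simp
  qed
qed simp

text \<open>
  As much is added in total as is removed, so each of the two uses at most half of the budget.
\<close>

lemma gain_le_half_budget:
  assumes d: "(dp, dm) \<in> diff_set L1 G w \<epsilon>" and p: "apath u p v"
  shows "(\<Sum>e\<leftarrow>p. dp e - dm e) \<le> \<epsilon> / 2"
proof -
  have pa: "set p \<subseteq> arcs G" "distinct p"
    using p apath_arcs apath_distinct by auto
  have "(\<Sum>e\<leftarrow>p. dp e - dm e) \<le> (\<Sum>e\<leftarrow>p. dp e)"
    using diff_setD(2)[OF d] pa by (intro sum_list_mono) auto
  also have "\<dots> = (\<Sum>e\<in>set p. dp e)"
    using pa by (simp add: sum_list_distinct_conv_sum_set)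
  also have "\<dots> \<le> (\<Sum>e\<in>arcs G. dp e)"
    using diff_setD(1)[OF d] pa by (intro sum_mono2) auto
  also have "\<dots> \<le> \<epsilon> / 2"
  proof -
    have "(\<Sum>e\<in>arcs G. \<bar>dp e\<bar>) = (\<Sum>e\<in>arcs G. dp e)" "(\<Sum>e\<in>arcs G. \<bar>dm e\<bar>) = (\<Sum>e\<in>arcs G. dm e)"
      using diff_setD(1,2)[OF d] by (auto intro: sum.cong)
    moreover have "(\<Sum>e\<in>arcs G. \<bar>dp e\<bar>) + (\<Sum>e\<in>arcs G. \<bar>dm e\<bar>) \<le> \<epsilon>"
      using d by (auto simp: diff_set_def)
    ultimately show ?thesis using sum_dp_eq_sum_dm[OF d] by simp
  qed
  finally show ?thesis .
qed

section \<open>Attaining the bounds\<close>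

definition max_gain :: "'e list \<Rightarrow> real" where
  "max_gain p = min \<epsilon> (in_supply s) + (\<Sum>e\<leftarrow>p. chi e)"

lemma max_gain_nonneg: "set p \<subseteq> arcs G \<Longrightarrow> 0 \<le> max_gain p"
  unfolding max_gain_def using chi_nonneg in_supply_nonneg eps_nonneg
  by (intro add_nonneg_nonneg sum_list_nonneg) auto

text \<open>
  A vertex that a path arc leaves passes on the fraction \<open>l\<close> of the most it can usefully pass on, taken
  from its entering off-path arcs in proportion to their capacities \<open>min \<epsilon> w\<^sub>e\<close>. The case \<open>l = 1\<close> is
  optimal in the sup-norm regime, and a smaller \<open>l\<close> makes the same perturbation fit the \<open>L\<^sub>1\<close> budget.
\<close>

lemma scaled_perturbation:
  assumes p: "apath s p t" and l: "0 \<le> l" "l \<le> 1"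
  obtains dp dm where
    "dp \<in> arcs G \<rightarrow>\<^sub>E {0..}" "dm \<in> arcs G \<rightarrow>\<^sub>E {0..}"
    "\<forall>u\<in>verts G. (\<Sum>e\<in>in_arcs G u. dm e) = (\<Sum>e\<in>out_arcs G u. dp e)"
    "\<forall>e\<in>arcs G. dm e \<le> w e" "\<forall>e\<in>arcs G. dp e \<le> \<epsilon> \<and> dm e \<le> \<epsilon>"
    "(\<Sum>e\<in>arcs G. dp e) = l * max_gain p"
    "(\<Sum>e\<leftarrow>p. dp e - dm e) = l * max_gain p"
proof -
  have pa: "set p \<subseteq> arcs G" "distinct p" "awalk s p t"
    using p apath_arcs apath_distinct by (auto simp: apath_def)
  define avail where "avail u = (\<Sum>e\<in>in_arcs G u - set p. min \<epsilon> (w e))" for u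
  define x where "x u = (if u \<in> tail G ` set p then l * min \<epsilon> (avail u) else 0)" for u
  define dp where "dp = (\<lambda>e\<in>arcs G. if e \<in> set p then x (tail G e) else 0)"
  define dm where "dm = (\<lambda>e\<in>arcs G. if e \<in> set p then 0
      else x (head G e) / avail (head G e) * min \<epsilon> (w e))"
  have avail_nonneg: "0 \<le> avail u" for u
    unfolding avail_def using w_nonneg eps_nonneg by (intro sum_nonneg) auto
  have x_bounds: "0 \<le> x u" "x u \<le> avail u" "x u \<le> \<epsilon>" for u
  proof -
    define m where "m = min \<epsilon> (avail u)"
    have m: "0 \<le> m" "m \<le> \<epsilon>" "m \<le> avail u" using avail_nonneg eps_nonneg by (simp_all add: m_def)
    then have "0 \<le> l * m" "l * m \<le> m"
      using l by (simp_all add: mult_left_le_one_le)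
    with m show "0 \<le> x u" "x u \<le> avail u" "x u \<le> \<epsilon>"
      by (simp_all add: x_def flip: m_def)
  qed
  have ratio: "0 \<le> x u / avail u" "x u / avail u \<le> 1" for u
    using x_bounds[of u] avail_nonneg[of u] by (auto simp: divide_le_eq_1)
  have dm_le: "0 \<le> dm e" "dm e \<le> min \<epsilon> (w e)" if e: "e \<in> arcs G" for e
  proof -
    have m: "0 \<le> min \<epsilon> (w e)" using w_nonneg[OF e] eps_nonneg by simp
    then show "0 \<le> dm e"
      using ratio(1) e unfolding dm_def by (simp del: min.bounded_iff times_divide_eq_left)
    have "x (head G e) / avail (head G e) * min \<epsilon> (w e) \<le> min \<epsilon> (w e)"
      using ratio m by (intro mult_left_le_one_le)
    then show "dm e \<le> min \<epsilon> (w e)"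
      using m e unfolding dm_def by (simp del: min.bounded_iff times_divide_eq_left)
  qed
  have dp_bounds: "0 \<le> dp e" "dp e \<le> \<epsilon>" if "e \<in> arcs G" for e
    using that x_bounds eps_nonneg by (auto simp: dp_def)
  have dom: "dp \<in> extensional (arcs G)" "dm \<in> extensional (arcs G)"
    by (auto simp: dp_def dm_def)
  have in_flow: "(\<Sum>e\<in>in_arcs G u. dm e) = x u" for u
  proof -
    have "(\<Sum>e\<in>in_arcs G u. dm e) = (\<Sum>e\<in>in_arcs G u - set p. dm e)"
      by (intro sum.mono_neutral_right) (auto simp: dm_def)
    also have "\<dots> = (\<Sum>e\<in>in_arcs G u - set p. x u / avail u * min \<epsilon> (w e))"
      by (intro sum.cong) (auto simp: dm_def)
    also have "\<dots> = x u / avail u * avail u"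
      by (simp only: sum_distrib_left[symmetric] avail_def)
    \<comment> \<open>If nothing is available, the division yields \<open>0\<close>, but then \<open>x u = 0\<close> as well.\<close>
    also have "\<dots> = x u"
      using x_bounds[of u] by (cases "avail u = 0") auto
    finally show ?thesis .
  qed
  have out_flow: "(\<Sum>e\<in>out_arcs G u. dp e) = x u" for u
  proof (cases "u \<in> tail G ` set p")
    case True
    then obtain a where a: "a \<in> set p" "tail G a = u" by auto
    have "(\<Sum>e\<in>out_arcs G u. dp e) = (\<Sum>e\<in>{a}. dp e)"
      using a pa apath_inj_tail[OF p]
      by (intro sum.mono_neutral_right) (auto simp: dp_def inj_on_def)
    then show ?thesis using a pa by (auto simp: dp_def)
  next
    case False
    have "(\<Sum>e\<in>out_arcs G u. dp e) = 0"
      using False by (intro sum.neutral) (auto simp: dp_def)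
    then show ?thesis using False by (simp add: x_def)
  qed
  have total: "(\<Sum>e\<leftarrow>p. dp e) = l * max_gain p"
  proof -
    \<comment> \<open>Shifting from tails to heads turns what the tail passes on into \<open>chi\<close> of the
        preceding arc; setting \<open>b t = 0\<close> makes this agree with \<open>chi\<close> on the last arc.\<close>
    define b where "b u = (if u = t then 0 else min \<epsilon> (avail u))" for u
    have "(\<Sum>e\<leftarrow>p. dp e) = (\<Sum>e\<leftarrow>p. l * b (tail G e))"
      using pa apath_tail_neq_end[OF p]
      by (intro arg_cong[of _ _ sum_list] map_cong) (auto simp: dp_def x_def b_def)
    also have "\<dots> = l * (b s + (\<Sum>e\<leftarrow>p. b (head G e)))"
      using awalk_shift_sum[OF pa(3), of b] by (simp add: sum_list_const_mult b_def)
    also have "b s = min \<epsilon> (in_supply s)"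
    proof -
      have "in_arcs G s - set p = in_arcs G s"
        using apath_head_neq_start[OF p] by auto
      then show ?thesis using s_neq_t by (simp add: b_def avail_def in_supply_def)
    qed
    also have "(\<Sum>e\<leftarrow>p. b (head G e)) = (\<Sum>e\<leftarrow>p. chi e)"
    proof (intro arg_cong[of _ _ sum_list] map_cong refl)
      fix e assume e: "e \<in> set p"
      then have "in_arcs G (head G e) - set p = in_arcs G (head G e) - {e}"
        using apath_inj_head[OF p] by (auto simp: inj_on_def)
      then show "b (head G e) = chi e"
        using in_supply_minus_arc[of e] e pa(1) unfolding b_def chi_def avail_def
        by (simp add: subset_iff)
    qed
    finally show ?thesis by (simp add: max_gain_def)
  qed
  have "(\<Sum>e\<in>arcs G. dp e) = (\<Sum>e\<in>set p. dp e)"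
    using pa by (intro sum.mono_neutral_right) (auto simp: dp_def)
  with total pa have "(\<Sum>e\<in>arcs G. dp e) = l * max_gain p"
    by (simp add: sum_list_distinct_conv_sum_set)
  moreover have "(\<Sum>e\<leftarrow>p. dp e - dm e) = (\<Sum>e\<leftarrow>p. dp e)"
    using pa by (intro arg_cong[of _ _ sum_list] map_cong) (auto simp: dm_def)
  ultimately show thesis
    using total in_flow out_flow dm_le dp_bounds dom
    by (intro that[of dp dm]) (auto simp: PiE_iff)
qed

section \<open>Worst-case costs of simple paths\<close>

lemma worst_case_cost_eqI:
  assumes "d \<in> D" "\<And>d'. d' \<in> D \<Longrightarrow> perturbed_cost G w f d' \<le> perturbed_cost G w f d"
  shows "worst_case_cost G w D f = perturbed_cost G w f d"
  unfolding worst_case_cost_def using assms by (intro cSup_eq_maximum) auto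

lemma apath_nonempty: "apath s p t \<Longrightarrow> p \<noteq> []"
  using s_neq_t by (auto simp: apath_simps)

lemma apath_hd: "apath s p t \<Longrightarrow> hd p \<in> arcs G \<and> tail G (hd p) = s"
  using apath_nonempty[of p] by (cases p) (auto simp: apath_Cons_iff)

text \<open>
  The first arc of the path receives at most \<open>min \<epsilon> T\<^sub>s\<close>, which turns the bound of \<open>gain_le\<close> into the gain of
  \<open>scaled_perturbation\<close> for \<open>l = 1\<close>.
\<close>

lemma worst_case_LInf:
  assumes p: "apath s p t"
  shows "worst_case_cost G w (diff_set LInf G w \<epsilon>) (incidence_vector G p)
    = awalk_cost wwc p + min \<epsilon> (in_supply s)"
proof -
  have pa: "set p \<subseteq> arcs G" using p by (rule apath_arcs)
  obtain dp dm where d: "dp \<in> arcs G \<rightarrow>\<^sub>E {0..}" "dm \<in> arcs G \<rightarrow>\<^sub>E {0..}"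
    "\<forall>u\<in>verts G. (\<Sum>e\<in>in_arcs G u. dm e) = (\<Sum>e\<in>out_arcs G u. dp e)"
    "\<forall>e\<in>arcs G. dm e \<le> w e" "\<forall>e\<in>arcs G. dp e \<le> \<epsilon> \<and> dm e \<le> \<epsilon>"
    "(\<Sum>e\<leftarrow>p. dp e - dm e) = max_gain p"
    by (rule scaled_perturbation[OF p, of 1]) auto
  have "pair_norm LInf (arcs G) (dp, dm) \<le> \<epsilon>"
    using d(1,2,5) eps_nonneg by (auto simp: PiE_iff)
  then have mem: "(dp, dm) \<in> diff_set LInf G w \<epsilon>"
    using d by (auto simp: diff_set_def)
  have cost: "perturbed_cost G w (incidence_vector G p) (dp, dm) = awalk_cost wwc p + min \<epsilon> (in_supply s)"
    using d(6) by (simp add: perturbed_cost_apath[OF p] awalk_cost_wwc[OF pa] max_gain_def)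
  show ?thesis
    unfolding cost[symmetric]
  proof (rule worst_case_cost_eqI[OF mem])
    fix d' assume "d' \<in> diff_set LInf G w \<epsilon>"
    then obtain dp' dm' where d': "d' = (dp', dm')" "(dp', dm') \<in> diff_set LInf G w \<epsilon>"
      by (cases d') auto
    have "dp' (hd p) \<le> min \<epsilon> (in_supply s)"
      using dp_le_in_supply[OF d'(2), of "hd p"] diff_setD(3)[OF d'(2), of "hd p"] apath_hd[OF p] by simp
    with gain_le[OF d'(2) p apath_nonempty[OF p]]
    have "perturbed_cost G w (incidence_vector G p) d' \<le> awalk_cost wwc p + min \<epsilon> (in_supply s)"
      unfolding d'(1) perturbed_cost_apath[OF p] awalk_cost_wwc[OF pa] by linarith
    then show "perturbed_cost G w (incidence_vector G p) d'
        \<le> perturbed_cost G w (incidence_vector G p) (dp, dm)"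
      unfolding cost .
  qed
qed

text \<open>
  The path gains at most \<open>min (\<epsilon> / 2) (max_gain p)\<close>. The formula has \<open>T\<^sub>s\<close> in place of the
  \<open>min \<epsilon> T\<^sub>s\<close> in \<open>max_gain\<close>; this changes nothing, since the two differ only if \<open>T\<^sub>s > \<epsilon>\<close>, and then the
  cap \<open>\<epsilon> / 2\<close> is the smaller bound with either.
\<close>

lemma worst_case_L1:
  assumes p: "apath s p t"
  shows "worst_case_cost G w (diff_set L1 G w \<epsilon>) (incidence_vector G p)
    = min (awalk_cost wwc p + in_supply s) (awalk_cost w p + \<epsilon> / 2)"
proof -
  have pa: "set p \<subseteq> arcs G" using p by (rule apath_arcs)
  have chis: "0 \<le> (\<Sum>e\<leftarrow>p. chi e)"
    using pa chi_nonneg by (intro sum_list_nonneg) auto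
  define S where "S = max_gain p"
  have S: "0 \<le> S" using max_gain_nonneg[OF pa] by (simp add: S_def)
  \<comment> \<open>The largest factor up to \<open>1\<close> for which the total added, and so the total removed, is at most \<open>\<epsilon> / 2\<close>.\<close>
  define l where "l = (if S \<le> \<epsilon> / 2 then 1 else \<epsilon> / 2 / S)"
  have l: "0 \<le> l" "l \<le> 1" "l * S = min (\<epsilon> / 2) S"
    using S eps_nonneg by (auto simp: l_def field_simps)
  obtain dp dm where d: "dp \<in> arcs G \<rightarrow>\<^sub>E {0..}" "dm \<in> arcs G \<rightarrow>\<^sub>E {0..}"
    "\<forall>u\<in>verts G. (\<Sum>e\<in>in_arcs G u. dm e) = (\<Sum>e\<in>out_arcs G u. dp e)"
    "\<forall>e\<in>arcs G. dm e \<le> w e" "(\<Sum>e\<in>arcs G. dp e) = l * S"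
    "(\<Sum>e\<leftarrow>p. dp e - dm e) = l * S"
    unfolding S_def by (rule scaled_perturbation[OF p l(1,2)])
  have "(\<Sum>e\<in>arcs G. \<bar>dp e\<bar>) = l * S" "(\<Sum>e\<in>arcs G. \<bar>dm e\<bar>) = (\<Sum>e\<in>arcs G. dm e)"
    using d(1,2,5) by (auto simp: PiE_iff intro!: sum.cong)
  moreover have "(\<Sum>e\<in>arcs G. dm e) = l * S"
    unfolding d(5)[symmetric] sum_arcs_by_head[of dm] sum_arcs_by_tail[of dp] using d(3) by simp
  ultimately have "pair_norm L1 (arcs G) (dp, dm) \<le> \<epsilon>"
    using l(3) by simp
  then have mem: "(dp, dm) \<in> diff_set L1 G w \<epsilon>"
    using d by (auto simp: diff_set_def)
  have cost: "perturbed_cost G w (incidence_vector G p) (dp, dm)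
      = min (awalk_cost wwc p + in_supply s) (awalk_cost w p + \<epsilon> / 2)"
    using d(6) l(3) chis eps_nonneg
    by (simp add: perturbed_cost_apath[OF p] awalk_cost_wwc[OF pa] S_def max_gain_def)
  show ?thesis
    unfolding cost[symmetric]
  proof (rule worst_case_cost_eqI[OF mem])
    fix d' assume "d' \<in> diff_set L1 G w \<epsilon>"
    then obtain dp' dm' where d': "d' = (dp', dm')" "(dp', dm') \<in> diff_set L1 G w \<epsilon>"
      by (cases d') auto
    have "dp' (hd p) \<le> in_supply s"
      using dp_le_in_supply[OF d'(2), of "hd p"] apath_hd[OF p] by simp
    with gain_le[OF d'(2) p apath_nonempty[OF p]] gain_le_half_budget[OF d'(2) p]
    have "perturbed_cost G w (incidence_vector G p) d'
        \<le> min (awalk_cost wwc p + in_supply s) (awalk_cost w p + \<epsilon> / 2)"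
      unfolding d'(1) perturbed_cost_apath[OF p] awalk_cost_wwc[OF pa] by linarith
    then show "perturbed_cost G w (incidence_vector G p) d'
        \<le> perturbed_cost G w (incidence_vector G p) (dp, dm)"
      unfolding cost .
  qed
qed

section \<open>Reduction to simple paths\<close>

lemma worst_case_cost_mono:
  assumes "\<And>d. d \<in> diff_set r G w \<epsilon> \<Longrightarrow> perturbed_cost G w f d \<le> perturbed_cost G w g d"
  shows "worst_case_cost G w (diff_set r G w \<epsilon>) f \<le> worst_case_cost G w (diff_set r G w \<epsilon>) g"
proof -
  obtain d where "d \<in> diff_set r G w \<epsilon>"
    "\<And>d'. d' \<in> diff_set r G w \<epsilon> \<Longrightarrow> perturbed_cost G w g d' \<le> perturbed_cost G w g d"
    using max_attained[of g r] by (auto simp: is_arg_max_def not_less)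
  then have "bdd_above (perturbed_cost G w g ` diff_set r G w \<epsilon>)"
    by (auto intro!: bdd_aboveI)
  then show ?thesis
    unfolding worst_case_cost_def using assms zero_in_diff_set by (intro cSUP_mono) auto
qed

text \<open>
  The arcs of \<open>g\<close> outside the contained path have weight \<open>w e + dp e - dm e \<ge> 0\<close> under every feasible
  perturbation.
\<close>

lemma apath_cheapest_in_path_vector:
  assumes g: "g \<in> path_vectors G s t"
  obtains p where "apath s p t"
    "worst_case_cost G w (diff_set r G w \<epsilon>) (incidence_vector G p)
      \<le> worst_case_cost G w (diff_set r G w \<epsilon>) g"
proof -
  obtain p where p: "apath s p t" "\<forall>e\<in>set p. g e = 1"
    using path_vector_contains_apath[OF g s_vert s_neq_t] by auto
  have "perturbed_cost G w (incidence_vector G p) d \<le> perturbed_cost G w g d"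
    if d: "d \<in> diff_set r G w \<epsilon>" for d
  proof -
    obtain dp dm where dd: "d = (dp, dm)" by (cases d)
    have "incidence_vector G p e * (w e + dp e - dm e) \<le> g e * (w e + dp e - dm e)"
      if e: "e \<in> arcs G" for e
    proof (intro mult_right_mono)
      show "incidence_vector G p e \<le> g e"
        using g p(2) e by (auto simp: incidence_vector_def path_vectors_def PiE_iff)
      show "0 \<le> w e + dp e - dm e"
        using diff_setD(1,4)[of dp dm r e] d dd e by auto
    qed
    then show ?thesis
      unfolding dd perturbed_cost_def by (auto intro: sum_mono)
  qed
  then show thesis using that p(1) worst_case_cost_mono by blast
qed

lemma optimal_if_best_apath:
  assumes p: "apath s p t"
    and best: "\<And>q. apath s q t \<Longrightarrow>
      worst_case_cost G w (diff_set r G w \<epsilon>) (incidence_vector G p)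
        \<le> worst_case_cost G w (diff_set r G w \<epsilon>) (incidence_vector G q)"
  shows "is_arg_min (worst_case_cost G w (diff_set r G w \<epsilon>)) (\<lambda>g. g \<in> path_vectors G s t)
      (incidence_vector G p)"
    and "worst_case_cost G w (diff_set r G w \<epsilon>) (incidence_vector G p)
      = opt_rsp G w s t (diff_set r G w \<epsilon>)"
proof -
  have le: "worst_case_cost G w (diff_set r G w \<epsilon>) (incidence_vector G p)
      \<le> worst_case_cost G w (diff_set r G w \<epsilon>) g" if "g \<in> path_vectors G s t" for g
    by (rule apath_cheapest_in_path_vector[OF that, of r]) (rule order_trans[OF best])
  have mem: "incidence_vector G p \<in> path_vectors G s t"
    using p by (rule incidence_vector_in_path_vectors)
  show "is_arg_min (worst_case_cost G w (diff_set r G w \<epsilon>)) (\<lambda>g. g \<in> path_vectors G s t)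
      (incidence_vector G p)"
    using le mem by (auto simp: is_arg_min_linorder)
  show "worst_case_cost G w (diff_set r G w \<epsilon>) (incidence_vector G p)
      = opt_rsp G w s t (diff_set r G w \<epsilon>)"
    unfolding opt_rsp_def using le mem finite_path_vectors
    by (intro Min_eqI[symmetric]) auto
qed

end

section \<open>Loops over adjacency lists\<close>

lemma fst_bind_timed: "fst (bind_timed m k) = fst (k (fst m))"
  and snd_bind_timed: "snd (bind_timed m k) = snd m + snd (k (fst m))"
  by (simp_all add: bind_timed_def)

lemmas timed_simps = fst_bind_timed snd_bind_timed return_def step_def

lemma fst_for_each: "fst (for_each xs body \<sigma>) = fold (\<lambda>x \<sigma>. fst (body x \<sigma>)) xs \<sigma>"
  by (induction xs arbitrary: \<sigma>) (auto simp: timed_simps)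

lemma snd_for_each_le:
  assumes "\<And>x \<sigma>. x \<in> set xs \<Longrightarrow> snd (body x \<sigma>) \<le> c x"
  shows "snd (for_each xs body \<sigma>) \<le> 1 + (\<Sum>x\<leftarrow>xs. 1 + c x)"
  using assms
proof (induction xs arbitrary: \<sigma>)
  case (Cons x xs)
  have "snd (body x \<sigma>) \<le> c x" using Cons.prems by simp
  moreover have "snd (for_each xs body (fst (body x \<sigma>))) \<le> 1 + (\<Sum>x\<leftarrow>xs. 1 + c x)"
    using Cons by auto
  ultimately show ?case by (simp add: timed_simps)
qed (simp add: timed_simps)

lemma snd_for_each_const_le:
  assumes "\<And>x \<sigma>. x \<in> set xs \<Longrightarrow> snd (body x \<sigma>) \<le> c"
  shows "snd (for_each xs body \<sigma>) \<le> 1 + (1 + c) * length xs"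
  using snd_for_each_le[of xs body "\<lambda>_. c" \<sigma>] assms by (simp add: sum_list_triv mult.commute)

text \<open>
  Applied with a projection \<open>g\<close>, this discards the components of a loop state that do not influence the
  one of interest.
\<close>

lemma fold_commute_proj:
  assumes "\<And>x \<sigma>. g (F x \<sigma>) = F' x (g \<sigma>)"
  shows "g (fold F xs \<sigma>) = fold F' xs (g \<sigma>)"
  by (induction xs arbitrary: \<sigma>) (auto simp: assms)

lemma fold_add_eq_sum_list:
  fixes h :: "'a \<Rightarrow> real"
  shows "fold (\<lambda>x acc. acc + h x) xs a = a + (\<Sum>x\<leftarrow>xs. h x)"
  by (induction xs arbitrary: a) auto

locale represented_digraph = fin_digraph G for G :: "('v, 'e) pre_digraph" +
  fixes R :: "('v, 'e) in_adjacency"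
  assumes repr: "represents R G"
begin

lemma set_vlist: "set (vlist R) = verts G" and distinct_vlist: "distinct (vlist R)"
  using repr by (auto simp: represents_def)

lemma inlist_arcs: "u \<in> verts G \<Longrightarrow> fst ` set (inlist R u) = in_arcs G u"
  using repr by (force simp: represents_def image_image)

lemma sum_inlist:
  assumes "u \<in> verts G"
  shows "(\<Sum>x\<leftarrow>inlist R u. h (fst x)) = (\<Sum>e\<in>in_arcs G u. h e)"
proof -
  have d: "distinct (inlist R u)" "set (inlist R u) = (\<lambda>e. (e, tail G e)) ` in_arcs G u"
    using repr assms by (auto simp: represents_def)
  have "(\<Sum>x\<leftarrow>inlist R u. h (fst x)) = (\<Sum>x\<in>set (inlist R u). h (fst x))"
    using d by (simp add: sum_list_distinct_conv_sum_set)
  also have "\<dots> = (\<Sum>e\<in>in_arcs G u. h e)"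
    unfolding d(2) by (subst sum.reindex) (auto simp: inj_on_def)
  finally show ?thesis .
qed

lemma sum_vlist: "(\<Sum>u\<leftarrow>vlist R. h u) = (\<Sum>u\<in>verts G. h u)"
  using distinct_vlist set_vlist by (simp add: sum_list_distinct_conv_sum_set)

lemma length_vlist: "length (vlist R) = card (verts G)"
  using distinct_vlist set_vlist distinct_card by metis

lemma sum_length_inlist: "(\<Sum>u\<leftarrow>vlist R. length (inlist R u)) = card (arcs G)"
proof -
  have "length (inlist R u) = (\<Sum>e\<in>in_arcs G u. 1)" if "u \<in> verts G" for u
    using sum_inlist[OF that, of "\<lambda>_. 1 :: nat"] by (simp add: sum_list_triv)
  then show ?thesis
    using sum_arcs_by_head[of "\<lambda>_. 1 :: nat"] by (simp add: sum_vlist)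
qed

text \<open>
  Each arc occurs in exactly one incoming list, so inner loops over these lists take a number of steps
  linear in the number of arcs altogether.
\<close>

lemma snd_vertex_loop_le:
  assumes "\<And>u \<sigma>. snd (body u \<sigma>) \<le> a + b * length (inlist R u)"
  shows "snd (for_each (vlist R) body \<sigma>) \<le> 1 + (1 + a) * card (verts G) + b * card (arcs G)"
proof -
  have "snd (for_each (vlist R) body \<sigma>)
      \<le> 1 + (\<Sum>u\<leftarrow>vlist R. 1 + (a + b * length (inlist R u)))"
    by (intro snd_for_each_le assms)
  also have "(\<Sum>u\<leftarrow>vlist R. 1 + (a + b * length (inlist R u)))
      = (1 + a) * length (vlist R) + b * (\<Sum>u\<leftarrow>vlist R. length (inlist R u))"
    by (simp add: sum_list_addf sum_list_Suc sum_list_triv sum_list_const_mult algebra_simps)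
  finally show ?thesis by (simp add: sum_length_inlist length_vlist)
qed

lemma fold_arc_updates:
  assumes "set us \<subseteq> verts G"
  shows "fold (\<lambda>u. fold (\<lambda>x f. f(fst x := h u (fst x))) (inlist R u)) us f
    = (\<lambda>e. if e \<in> arcs G \<and> head G e \<in> set us then h (head G e) e else f e)"
  using assms
proof (induction us arbitrary: f)
  case (Cons u us)
  have upd: "fold (\<lambda>x f. f(fst x := h u (fst x))) es f
      = (\<lambda>e. if e \<in> fst ` set es then h u e else f e)" for es :: "('e \<times> 'v) list" and f
    by (induction es arbitrary: f) (auto simp: fun_eq_iff)
  have upd_u: "fold (\<lambda>x f. f(fst x := h u (fst x))) (inlist R u) f
      = (\<lambda>e. if e \<in> in_arcs G u then h u e else f e)"
    unfolding upd using inlist_arcs[of u] Cons.prems by simp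
  show ?case
    using Cons.prems unfolding fold_simps(2) upd_u by (subst Cons.IH) (auto intro!: ext)
qed simp

section \<open>Results and step counts of the subroutines\<close>

lemma snd_compute_T_le: "snd (compute_T R w \<epsilon>) \<le> 1 + 4 * card (verts G) + 4 * card (arcs G)"
proof -
  have inner: "snd (for_each es (\<lambda>(e, v) acc. do {
         we \<leftarrow> step (w e); c \<leftarrow> step (min \<epsilon> we); step (acc + c) }) a) \<le> 1 + 4 * length es"
    for es :: "('e \<times> 'v) list" and a
    by (rule order_trans[OF snd_for_each_const_le[where c=3]]) (auto simp: timed_simps split: prod.splits)
  show ?thesis
    unfolding compute_T_def
    by (rule order_trans[OF snd_vertex_loop_le[where a=3 and b=4]])
      (use inner in \<open>auto simp: timed_simps add.commute\<close>)
qed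

lemma fst_compute_T:
  assumes "u \<in> verts G"
  shows "fst (compute_T R w \<epsilon>) u = (\<Sum>e\<in>in_arcs G u. min \<epsilon> (w e))"
proof -
  have upd: "fold (\<lambda>u T. T(u := val u)) us T0 u = (if u \<in> set us then val u else T0 u)"
    for us and val :: "'v \<Rightarrow> real" and T0
    by (induction us arbitrary: T0) auto
  have "fst (compute_T R w \<epsilon>)
      = fold (\<lambda>u T. T(u := \<Sum>x\<leftarrow>inlist R u. min \<epsilon> (w (fst x)))) (vlist R) (\<lambda>_. undefined)"
    unfolding compute_T_def fst_for_each
    by (simp add: timed_simps fst_for_each split_beta fold_add_eq_sum_list)
  then show ?thesis
    using assms sum_inlist[OF assms, of "\<lambda>e. min \<epsilon> (w e)"] by (simp add: upd set_vlist)
qed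

lemma snd_compute_chi_wwc_le:
  "snd (compute_chi_wwc R w t \<epsilon> T) \<le> 1 + 5 * card (verts G) + 8 * card (arcs G)"
proof -
  have inner: "snd (for_each es (\<lambda>(e, v) (\<chi>, wwc). do {
         we \<leftarrow> step (w e);
         x \<leftarrow> (if is_t then step 0 else do {
           c \<leftarrow> step (min \<epsilon> we);
           r \<leftarrow> step (Tu - c);
           step (min \<epsilon> r)
         });
         \<chi>' \<leftarrow> step (\<chi>(e := x));
         y \<leftarrow> step (we + x);
         wwc' \<leftarrow> step (wwc(e := y));
         return (\<chi>', wwc')
       }) \<sigma>) \<le> 1 + 8 * length es"
    for es :: "('e \<times> 'v) list" and \<sigma> is_t Tu
    by (rule order_trans[OF snd_for_each_const_le[where c=7]]) (auto simp: timed_simps split: prod.splits)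
  show ?thesis
    unfolding compute_chi_wwc_def
    by (rule order_trans[OF snd_vertex_loop_le[where a=4 and b=8]])
      (use inner in \<open>auto simp: timed_simps\<close>)
qed

lemma fst_compute_chi_wwc:
  "snd (fst (compute_chi_wwc R w t \<epsilon> T)) = (\<lambda>e\<in>arcs G.
     w e + (if head G e = t then 0 else min \<epsilon> (T (head G e) - min \<epsilon> (w e))))"
proof -
  let ?y = "\<lambda>u e. w e + (if u = t then 0 else min \<epsilon> (T u - min \<epsilon> (w e)))"
  have "snd (fst (compute_chi_wwc R w t \<epsilon> T))
      = fold (\<lambda>u. fold (\<lambda>x f. f(fst x := ?y u (fst x))) (inlist R u)) (vlist R) (\<lambda>_. undefined)"
    unfolding compute_chi_wwc_def fst_for_each
    by (subst fold_commute_proj[where g=snd and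
          F'="\<lambda>u. fold (\<lambda>x f. f(fst x := ?y u (fst x))) (inlist R u)"])
      (auto simp: timed_simps fst_for_each split_beta intro!: fold_commute_proj)
  then show ?thesis
    by (auto simp: fold_arc_updates[where h = ?y] set_vlist fun_eq_iff)
qed

lemma snd_preprocess_le: "snd (preprocess R w s t \<epsilon>) \<le> 4 + 9 * card (verts G) + 12 * card (arcs G)"
  using snd_compute_T_le[of w \<epsilon>] snd_compute_chi_wwc_le[of w t \<epsilon> "fst (compute_T R w \<epsilon>)"]
  by (simp add: preprocess_def timed_simps split_beta)

lemma snd_compute_incidence_le:
  "snd (compute_incidence R p) \<le> 2 + 3 * card (verts G) + 2 * card (arcs G) + 2 * length p"
proof -
  have inner: "snd (for_each es (\<lambda>(e, v) f. step (f(e := 0))) f) \<le> 1 + 2 * length es"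
    for es :: "('e \<times> 'v) list" and f :: "'e \<Rightarrow> real"
    by (rule order_trans[OF snd_for_each_const_le[where c=1]]) (auto simp: timed_simps split: prod.splits)
  have zero: "snd (for_each (vlist R) (\<lambda>u f. do {
       es \<leftarrow> step (inlist R u);
       for_each es (\<lambda>(e, v) f. step (f(e := 0))) f
     }) (\<lambda>_. undefined :: real)) \<le> 1 + 3 * card (verts G) + 2 * card (arcs G)"
    by (rule order_trans[OF snd_vertex_loop_le[where a=2 and b=2]])
      (use inner in \<open>auto simp: timed_simps\<close>)
  have "snd (for_each p (\<lambda>e f. step (f(e := 1))) f) \<le> 1 + 2 * length p" for f :: "'e \<Rightarrow> real"
    by (rule order_trans[OF snd_for_each_const_le[where c=1]]) (auto simp: timed_simps split: prod.splits)
  from add_mono[OF zero this] show ?thesis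
    unfolding compute_incidence_def snd_bind_timed by (rule order_trans) simp
qed

lemma fst_compute_incidence:
  assumes "set p \<subseteq> arcs G"
  shows "fst (compute_incidence R p) = incidence_vector G p"
proof -
  have ones: "fold (\<lambda>e f. f(e := 1)) q f = (\<lambda>e. if e \<in> set q then 1 else f e)"
    for q and f :: "'e \<Rightarrow> real"
    by (induction q arbitrary: f) (auto simp: fun_eq_iff)
  have "fst (compute_incidence R p) = fold (\<lambda>e f. f(e := 1)) p
      (fold (\<lambda>u. fold (\<lambda>x f. f(fst x := 0)) (inlist R u)) (vlist R) (\<lambda>_. undefined))"
    by (simp add: compute_incidence_def timed_simps fst_for_each split_beta)
  then show ?thesis
    using assms by (auto simp: ones fold_arc_updates[where h="\<lambda>_ _. 0"] set_vlist incidence_vector_def fun_eq_iff)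
qed

lemma snd_compute_inner_le: "snd (compute_inner R x f) \<le> 1 + 3 * card (verts G) + 5 * card (arcs G)"
proof -
  have inner: "snd (for_each es (\<lambda>(e, v) acc. do {
         xe \<leftarrow> step (x e);
         fe \<leftarrow> step (f e);
         m \<leftarrow> step (xe * fe);
         step (acc + m)
       }) a) \<le> 1 + 5 * length es"
    for es :: "('e \<times> 'v) list" and a
    by (rule order_trans[OF snd_for_each_const_le[where c=4]]) (auto simp: timed_simps split: prod.splits)
  show ?thesis
    unfolding compute_inner_def
    by (rule order_trans[OF snd_vertex_loop_le[where a=2 and b=5]])
      (use inner in \<open>auto simp: timed_simps\<close>)
qed

lemma fst_compute_inner: "fst (compute_inner R x f) = (\<Sum>e\<in>arcs G. x e * f e)"
proof -
  have "fst (compute_inner R x f)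
      = (\<Sum>u\<leftarrow>vlist R. \<Sum>y\<leftarrow>inlist R u. x (fst y) * f (fst y))"
    by (simp add: compute_inner_def timed_simps fst_for_each split_beta
        fold_add_eq_sum_list)
  also have "\<dots> = (\<Sum>u\<in>verts G. \<Sum>e\<in>in_arcs G u. x e * f e)"
    using sum_inlist[of _ "\<lambda>e. x e * f e"] by (simp add: sum_vlist)
  finally show ?thesis by (simp add: sum_arcs_by_head)
qed

lemma fst_compute_inner_incidence:
  assumes "apath u p v"
  shows "fst (compute_inner R x (fst (compute_incidence R p))) = awalk_cost x p"
proof -
  have "awalk_cost x p = (\<Sum>e\<leftarrow>p. x e)" by (induction p) auto
  then show ?thesis
    using sum_incidence_vector[OF assms, of x]
    by (simp add: fst_compute_inner fst_compute_incidence[OF apath_arcs[OF assms]] mult.commute)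
qed

end

section \<open>Correctness and running time\<close>

lemma sp_instance_robust:
  assumes "sp_instance G R w s t" "0 \<le> \<epsilon>"
  shows "robust_sp G w s t \<epsilon>" "represented_digraph G R"
  using assms
  by (auto simp: sp_instance_def robust_sp_def robust_sp_axioms_def
      represented_digraph_def represented_digraph_axioms_def)

lemma sp_instance_wwc:
  assumes "sp_instance G R w s t" "0 \<le> \<epsilon>"
  shows "sp_instance G R (robust_sp.wwc G w t \<epsilon>) s t"
proof -
  interpret robust_sp G w s t \<epsilon> using assms by (rule sp_instance_robust)
  show ?thesis
    using assms chi_nonneg w_nonneg by (auto simp: sp_instance_def wwc_def)
qed

lemma fst_preprocess:
  assumes "sp_instance G R w s t" "0 \<le> \<epsilon>"
  obtains T \<chi> where
    "fst (preprocess R w s t \<epsilon>) = (T, \<chi>, robust_sp.wwc G w t \<epsilon>, min \<epsilon> (robust_sp.in_supply G w \<epsilon> s))"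
    "T s = robust_sp.in_supply G w \<epsilon> s"
proof -
  interpret robust_sp G w s t \<epsilon> using assms by (rule sp_instance_robust)
  interpret represented_digraph G R using assms by (rule sp_instance_robust)
  define T where "T = fst (compute_T R w \<epsilon>)"
  have T: "T u = in_supply u" if "u \<in> verts G" for u
    using fst_compute_T[OF that] by (simp add: T_def in_supply_def)
  have "snd (fst (compute_chi_wwc R w t \<epsilon> T)) = wwc"
    by (auto simp: fst_compute_chi_wwc wwc_def chi_def T fun_eq_iff restrict_def)
  then have "fst (preprocess R w s t \<epsilon>) = (T, fst (fst (compute_chi_wwc R w t \<epsilon> T)), wwc, min \<epsilon> (in_supply s))"
    by (simp add: preprocess_def timed_simps split_beta T s_vert flip: T_def)
  then show thesis using that T s_vert by blast
qed

lemma dijkstra_shortest_path: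
  assumes "dijkstra_procedure dijkstra" "sp_instance G R w s t"
  shows "pre_digraph.apath G s (fst (dijkstra R w s t)) t"
    "\<And>q. pre_digraph.apath G s q t \<Longrightarrow>
      wf_digraph.awalk_cost w (fst (dijkstra R w s t)) \<le> wf_digraph.awalk_cost w q"
  using assms unfolding dijkstra_procedure_def shortest_path_def is_arg_min_linorder by blast+

text \<open>
  In the \<open>L\<^sub>1\<close> regime the worst case of every path is the minimum of its two values, so the smaller of
  the two minima is a lower bound for all paths. The worst case of the returned path is at most
  the returned value, and the lower bound makes this an equality.
\<close>

lemma short_term_rsp_correct:
  assumes dijkstra: "dijkstra_procedure dijkstra" and inst: "sp_instance G R w s t" "0 \<le> \<epsilon>"
    and run: "fst (short_term_rsp dijkstra r R w s t \<epsilon>) = (f, val)"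
  shows "\<exists>p. pre_digraph.apath G s p t \<and> f = incidence_vector G p \<and>
    val = worst_case_cost G w (diff_set r G w \<epsilon>) f \<and>
    (\<forall>q. pre_digraph.apath G s q t \<longrightarrow>
      val \<le> worst_case_cost G w (diff_set r G w \<epsilon>) (incidence_vector G q))"
proof -
  interpret robust_sp G w s t \<epsilon> using inst by (rule sp_instance_robust)
  interpret represented_digraph G R using inst by (rule sp_instance_robust)
  obtain T \<chi> where pre: "fst (preprocess R w s t \<epsilon>) = (T, \<chi>, wwc, min \<epsilon> (in_supply s))"
    "T s = in_supply s"
    using fst_preprocess[OF inst] .
  define p1 p0 where "p1 = fst (dijkstra R wwc s t)" and "p0 = fst (dijkstra R w s t)"
  have p1: "apath s p1 t" "\<And>q. apath s q t \<Longrightarrow> awalk_cost wwc p1 \<le> awalk_cost wwc q"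
    unfolding p1_def using dijkstra_shortest_path[OF dijkstra sp_instance_wwc[OF inst]] by auto
  have p0: "apath s p0 t" "\<And>q. apath s q t \<Longrightarrow> awalk_cost w p0 \<le> awalk_cost w q"
    unfolding p0_def using dijkstra_shortest_path[OF dijkstra inst(1)] by auto
  note inc = fst_compute_incidence[OF apath_arcs[OF p1(1)]] fst_compute_incidence[OF apath_arcs[OF p0(1)]]
  note cost = fst_compute_inner_incidence[OF p1(1), of wwc, unfolded inc]
    fst_compute_inner_incidence[OF p0(1), of w, unfolded inc]
  show ?thesis
  proof (cases r)
    case LInf
    have "f = incidence_vector G p1" "val = awalk_cost wwc p1 + min \<epsilon> (in_supply s)"
      using run unfolding LInf
      by (simp_all add: timed_simps pre inc cost flip: p1_def)
    then show ?thesis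
      unfolding LInf using p1 by (auto simp: worst_case_LInf)
  next
    case L1
    define v1 v0 where "v1 = awalk_cost wwc p1 + in_supply s" and "v0 = awalk_cost w p0 + \<epsilon> / 2"
    have out: "(f, val) = (if v1 \<le> v0 then (incidence_vector G p1, v1) else (incidence_vector G p0, v0))"
      using run unfolding L1 v1_def v0_def
      by (simp add: timed_simps pre inc cost flip: p1_def p0_def split: if_splits)
    have le: "min v1 v0 \<le> worst_case_cost G w (diff_set L1 G w \<epsilon>) (incidence_vector G q)"
      if "apath s q t" for q
      using p1(2)[OF that] p0(2)[OF that] by (auto simp: worst_case_L1[OF that] v1_def v0_def)
    have "worst_case_cost G w (diff_set L1 G w \<epsilon>) (incidence_vector G p1) \<le> v1"
      "worst_case_cost G w (diff_set L1 G w \<epsilon>) (incidence_vector G p0) \<le> v0"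
      by (auto simp: worst_case_L1[OF p1(1)] worst_case_L1[OF p0(1)] v1_def v0_def)
    with le[OF p1(1)] le[OF p0(1)]
    have "v1 \<le> v0 \<Longrightarrow> v1 = worst_case_cost G w (diff_set L1 G w \<epsilon>) (incidence_vector G p1)"
      "\<not> v1 \<le> v0 \<Longrightarrow> v0 = worst_case_cost G w (diff_set L1 G w \<epsilon>) (incidence_vector G p0)"
      by linarith+
    then show ?thesis
      unfolding L1 using out le p1(1) p0(1) by (cases "v1 \<le> v0") (auto simp: min_def)
  qed
qed

text \<open>
  One bound for both regimes, counting two calls even where only one is made. Apart from the calls, there are
  at most \<open>25 * |V| + 26 * |E| + 15\<close> steps, and \<open>|V| \<ge> 2\<close> absorbs the constant.
\<close>

lemma snd_short_term_rsp_le: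
  assumes dijkstra: "dijkstra_procedure dijkstra" and inst: "sp_instance G R w s t" "0 \<le> \<epsilon>"
  shows "snd (short_term_rsp dijkstra r R w s t \<epsilon>)
    \<le> 40 * (card (verts G) + card (arcs G))
        + snd (dijkstra R (robust_sp.wwc G w t \<epsilon>) s t) + snd (dijkstra R w s t)"
proof -
  interpret robust_sp G w s t \<epsilon> using inst by (rule sp_instance_robust)
  interpret represented_digraph G R using inst by (rule sp_instance_robust)
  obtain T \<chi> where pre: "fst (preprocess R w s t \<epsilon>) = (T, \<chi>, wwc, min \<epsilon> (in_supply s))"
    using fst_preprocess[OF inst] .
  define p1 p0 where "p1 = fst (dijkstra R wwc s t)" and "p0 = fst (dijkstra R w s t)"
  define n m where "n = card (verts G)" and "m = card (arcs G)"
  have len: "length p1 < n" "length p0 < n"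
    using length_apath_less dijkstra_shortest_path(1)[OF dijkstra] inst sp_instance_wwc[OF inst]
    unfolding p1_def p0_def n_def by blast+
  have incs: "snd (compute_incidence R p1) \<le> 2 + 5 * n + 2 * m"
    "snd (compute_incidence R p0) \<le> 2 + 5 * n + 2 * m"
    using snd_compute_incidence_le[of p1] snd_compute_incidence_le[of p0] len
    by (simp_all flip: n_def m_def)
  have inn: "snd (compute_inner R x f) \<le> 1 + 3 * n + 5 * m" for x f
    using snd_compute_inner_le by (simp flip: n_def m_def)
  have prep: "snd (preprocess R w s t \<epsilon>) \<le> 4 + 9 * n + 12 * m"
    using snd_preprocess_le by (simp flip: n_def m_def)
  have "card {s, t} \<le> n"
    unfolding n_def using inst by (intro card_mono) (auto simp: sp_instance_def)
  then have n: "2 \<le> n" using s_neq_t by simp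
  show ?thesis
    unfolding n_def[symmetric] m_def[symmetric]
  proof (cases r)
    case LInf
    show "snd (short_term_rsp dijkstra r R w s t \<epsilon>)
        \<le> 40 * (n + m) + snd (dijkstra R wwc s t) + snd (dijkstra R w s t)"
      unfolding LInf
      using prep incs(1) inn[of wwc "fst (compute_incidence R p1)"] n
      by (simp add: timed_simps pre flip: p1_def)
  next
    case L1
    show "snd (short_term_rsp dijkstra r R w s t \<epsilon>)
        \<le> 40 * (n + m) + snd (dijkstra R wwc s t) + snd (dijkstra R w s t)"
      unfolding L1
      using prep incs inn[of wwc "fst (compute_incidence R p1)"] inn[of w "fst (compute_incidence R p0)"] n
      by (simp add: timed_simps pre flip: p1_def p0_def)
  qed
qed

lemma le_two_times_ln:
  assumes "2 \<le> n"
  shows "real n \<le> 2 * (real n * ln (real n))"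
proof -
  have "1 / 2 \<le> ln (2 :: real)" using exp_half_le2 by (subst ln_ge_iff) auto
  also have "\<dots> \<le> ln (real n)" using assms by simp
  finally have "real n * (1 / 2) \<le> real n * ln (real n)" by (intro mult_left_mono) auto
  then show ?thesis by simp
qed

text \<open>
  The constant for the procedure holds uniformly over all its inputs, in particular for the weights
  \<open>wwc\<close>, which form an instance on the same graph since \<open>chi\<close> is nonnegative.
\<close>

lemma short_term_rsp_bigo:
  assumes dijkstra: "dijkstra_procedure dijkstra"
  shows "(\<lambda>(G, R, w, s, t, \<epsilon>). real (snd (short_term_rsp dijkstra r R w s t \<epsilon>)))
         \<in> O[principal {(G, R, w, s, t, \<epsilon>). sp_instance G R w s t \<and> 0 \<le> \<epsilon>}](\<lambda>(G, R, w, s, t, \<epsilon>).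
             real (card (arcs G)) + real (card (verts G)) * ln (real (card (verts G))))"
proof -
  define B where "B G = real (card (arcs G)) + real (card (verts G)) * ln (real (card (verts G)))"
    for G :: "('a, 'b) pre_digraph"
  have "(\<lambda>(G, R, w, s, t). real (snd (dijkstra R w s t)))
      \<in> O[principal {(G, R, w, s, t). sp_instance G R w s t}](\<lambda>(G, R, w, s, t). B G)"
    using dijkstra by (simp add: dijkstra_procedure_def B_def)
  then obtain c where c: "\<And>G R w s t. sp_instance G R w s t \<Longrightarrow>
      real (snd (dijkstra R w s t)) \<le> c * \<bar>B G\<bar>"
    by (elim landau_o.bigE) (auto simp: eventually_principal)
  \<comment> \<open>Two calls cost \<open>2 * c\<close>; the other \<open>40 * (|V| + |E|)\<close> steps are at most \<open>80\<close> times the bound.\<close>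
  have "real (snd (short_term_rsp dijkstra r R w s t \<epsilon>)) \<le> (80 + 2 * c) * \<bar>B G\<bar>"
    if inst: "sp_instance G R w s t" "0 \<le> \<epsilon>" for G R w s t \<epsilon>
  proof -
    let ?n = "card (verts G)" and ?m = "card (arcs G)"
    have "card {s, t} \<le> ?n"
      using inst fin_digraph.finite_verts by (intro card_mono) (auto simp: sp_instance_def)
    then have n: "2 \<le> ?n" using inst by (simp add: sp_instance_def)
    have "real (?n + ?m) \<le> 2 * B G"
      using add_mono[OF le_two_times_ln[OF n], of "real ?m" "2 * real ?m"]
      by (simp add: B_def algebra_simps)
    then have "real (?n + ?m) \<le> 2 * \<bar>B G\<bar>"
      using abs_ge_self[of "B G"] by linarith
    moreover have "real (snd (short_term_rsp dijkstra r R w s t \<epsilon>))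
        \<le> 40 * real (?n + ?m) + real (snd (dijkstra R (robust_sp.wwc G w t \<epsilon>) s t))
            + real (snd (dijkstra R w s t))"
      using snd_short_term_rsp_le[OF dijkstra inst, of r] by linarith
    ultimately show ?thesis
      using c[OF inst(1)] c[OF sp_instance_wwc[OF inst]] by (simp add: algebra_simps)
  qed
  then show ?thesis
    by (intro bigoI[where c = "80 + 2 * c"]) (auto simp: eventually_principal simp flip: B_def)
qed

theorem proposition2p2:
  fixes dijkstra ::
    "('v, 'e) in_adjacency \<Rightarrow> ('e \<Rightarrow> real) \<Rightarrow> 'v \<Rightarrow> 'v \<Rightarrow> 'e list timed"
  assumes "dijkstra_procedure dijkstra"
  shows
    "(\<forall>r G R w s t \<epsilon> f val.
       sp_instance G R w s t \<longrightarrow> 0 \<le> \<epsilon> \<longrightarrow>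
       fst (short_term_rsp dijkstra r R w s t \<epsilon>) = (f, val) \<longrightarrow>
         (\<forall>g\<in>path_vectors G s t.
            \<exists>d. is_arg_max (perturbed_cost G w g) (\<lambda>d. d \<in> diff_set r G w \<epsilon>) d) \<and>
         (\<exists>p. pre_digraph.apath G s p t \<and> f = incidence_vector G p) \<and>
         is_arg_min (worst_case_cost G w (diff_set r G w \<epsilon>)) (\<lambda>g. g \<in> path_vectors G s t) f \<and>
         val = opt_rsp G w s t (diff_set r G w \<epsilon>)) \<and>
     (\<forall>r. (\<lambda>(G, R, w, s, t, \<epsilon>). real (snd (short_term_rsp dijkstra r R w s t \<epsilon>)))
         \<in> O[principal {(G, R, w, s, t, \<epsilon>). sp_instance G R w s t \<and> 0 \<le> \<epsilon>}](\<lambda>(G, R, w, s, t, \<epsilon>).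
             real (card (arcs G)) + real (card (verts G)) * ln (real (card (verts G)))))"
proof (intro conjI allI impI)
  fix r and G :: "('v, 'e) pre_digraph" and R w s t \<epsilon> f val
  assume inst: "sp_instance G R w s t" "0 \<le> \<epsilon>"
    and run: "fst (short_term_rsp dijkstra r R w s t \<epsilon>) = (f, val)"
  interpret robust_sp G w s t \<epsilon> using inst by (rule sp_instance_robust)
  obtain p where p: "apath s p t" "f = incidence_vector G p"
    "val = worst_case_cost G w (diff_set r G w \<epsilon>) f"
    "\<And>q. apath s q t \<Longrightarrow> val \<le> worst_case_cost G w (diff_set r G w \<epsilon>) (incidence_vector G q)"
    using short_term_rsp_correct[OF assms inst run] by blast
  show "\<forall>g\<in>path_vectors G s t.
      \<exists>d. is_arg_max (perturbed_cost G w g) (\<lambda>d. d \<in> diff_set r G w \<epsilon>) d"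
    using max_attained by blast
  show "\<exists>p. apath s p t \<and> f = incidence_vector G p"
    using p by blast
  show "is_arg_min (worst_case_cost G w (diff_set r G w \<epsilon>)) (\<lambda>g. g \<in> path_vectors G s t) f"
    "val = opt_rsp G w s t (diff_set r G w \<epsilon>)"
    using optimal_if_best_apath[OF p(1), of r] p by auto
qed (rule short_term_rsp_bigo[OF assms])

end
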